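(* Let $n \ge 2$ and let $L \subset \mathbb{R}^n$ be a lattice of rank $n$. If $L$ is positive virtually rectangular (PVR), then $L^+$ contains at most $d+n-1$ indecomposable elements, where $$d = \min\{ [L:M] : M \subseteq L \text{ is a PR sublattice of finite index}\}.$$ Otherwise (i.e. if $L$ is not PVR), $L^+$ contains infinitely many indecomposable elements.
   Context: For a lattice $L\subset\mathbb{R}^n$ of rank $n$, let $L^+ = L \cap \mathbb{R}^n_{\ge 0} = \{x \in L : x_i \ge 0 \text{ for all } 1\le i\le n\}$. A nonzero vector $x \in L^+$ is decomposable if there exist nonzero $y,z \in L^+$ with $x = y+z$; otherwise the nonzero vector $x$ is indecomposable. A lattice of rank $n$ in $\mathbb{R}^n$ is positive rectangular (PR) if it has a basis consisting of pairwise orthogonal vectors all of whose coordinates are nonnegative. $L$ is positive virtually rectangular (PVR) if it contains a PR sublattice $M$ of finite index. *)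

theory Defs
  imports "HOL-Analysis.Analysis"
begin

definition lattice_basis :: "(real ^ 'n) set \<Rightarrow> (real ^ 'n) set \<Rightarrow> bool" where
  "lattice_basis B L \<longleftrightarrow>
     independent B \<and> L = {\<Sum>b\<in>B. of_int (c b) *\<^sub>R b | c :: real ^ 'n \<Rightarrow> int. True}"

definition full_lattice :: "(real ^ 'n) set \<Rightarrow> bool" where
  "full_lattice L \<longleftrightarrow> (\<exists>B. lattice_basis B L \<and> card B = CARD('n))"

definition nonneg_part :: "(real ^ 'n) set \<Rightarrow> (real ^ 'n) set" where
  "nonneg_part L = {x \<in> L. \<forall>i. 0 \<le> x $ i}"

definition decomposable :: "(real ^ 'n) set \<Rightarrow> real ^ 'n \<Rightarrow> bool" where
  "decomposable L x \<longleftrightarrow>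
     (\<exists>y\<in>nonneg_part L. \<exists>z\<in>nonneg_part L. y \<noteq> 0 \<and> z \<noteq> 0 \<and> x = y + z)"

definition indecomposables :: "(real ^ 'n) set \<Rightarrow> (real ^ 'n) set" where
  "indecomposables L = {x \<in> nonneg_part L. x \<noteq> 0 \<and> \<not> decomposable L x}"

definition positive_rectangular :: "(real ^ 'n) set \<Rightarrow> bool" where
  "positive_rectangular M \<longleftrightarrow>
     (\<exists>B. lattice_basis B M \<and> card B = CARD('n) \<and> pairwise orthogonal B \<and>
          (\<forall>b\<in>B. \<forall>i. 0 \<le> b $ i))"

definition cosets :: "(real ^ 'n) set \<Rightarrow> (real ^ 'n) set \<Rightarrow> (real ^ 'n) set set" where
  "cosets L M = (\<lambda>x. (+) x ` M) ` L"

text \<open>By the convention for \<^const>\<open>card\<close>, this is 0 when the index is infinite.\<close>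

definition lattice_index :: "(real ^ 'n) set \<Rightarrow> (real ^ 'n) set \<Rightarrow> nat" where
  "lattice_index L M = card (cosets L M)"

definition finite_index_PR_sublattice :: "(real ^ 'n) set \<Rightarrow> (real ^ 'n) set \<Rightarrow> bool" where
  "finite_index_PR_sublattice L M \<longleftrightarrow>
     M \<subseteq> L \<and> positive_rectangular M \<and> finite (cosets L M)"

definition positive_virtually_rectangular :: "(real ^ 'n) set \<Rightarrow> bool" where
  "positive_virtually_rectangular L \<longleftrightarrow> (\<exists>M. finite_index_PR_sublattice L M)"

text \<open>The minimum exists exactly when \<open>L\<close> is positive virtually rectangular; the value is
  not meaningful otherwise.\<close>

definition min_PR_index :: "(real ^ 'n) set \<Rightarrow> nat" where
  "min_PR_index L = (LEAST k. \<exists>M. finite_index_PR_sublattice L M \<and> k = lattice_index L M)"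

end

theory Submission
  imports Defs
begin

text \<open>
  A positive rectangular lattice is nothing but a box lattice \<open>\<Oplus>\<^sub>i \<int> a\<^sub>i e\<^sub>i\<close> with all
  \<open>a\<^sub>i > 0\<close>: orthogonal vectors with nonnegative coordinates have disjoint supports, and \<open>n\<close>
  nonzero vectors in dimension \<open>n\<close> with disjoint supports must lie on the \<open>n\<close> coordinate axes
  (\<open>positive_rectangular_iff_box_lattice\<close>).

  If \<open>L\<close> contains the box lattice \<open>M\<close> of the side lengths \<open>a\<^sub>i\<close>, then \<open>a\<^sub>i e\<^sub>i\<close> can be split off
  from any \<open>x \<in> L\<^sup>+\<close> with \<open>x\<^sub>i \<ge> a\<^sub>i\<close>. So an indecomposable vector is one of the \<open>n\<close> vectors
  \<open>a\<^sub>i e\<^sub>i\<close> or a nonzero point of the half-open box \<open>\<Prod>\<^sub>i [0, a\<^sub>i)\<close>. Distinct points of that box lie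
  in distinct cosets of \<open>M\<close>, and the coset \<open>M\<close> itself is taken by the origin, which leaves at
  most \<open>[L : M] - 1\<close> points of the second kind. Choosing \<open>M\<close> of least index gives the bound.

  Conversely, suppose that there are only finitely many indecomposable vectors. They generate
  \<open>L\<^sup>+\<close> as a monoid, because only finitely many lattice points lie below a given one. If none of
  them lay on the \<open>i\<close>-th axis, then each of them, and by additivity every \<open>x \<in> L\<^sup>+\<close>, would satisfy
  \<open>x\<^sub>i \<le> K \<Sum>\<^sub>j\<^sub>\<noteq>\<^sub>i x\<^sub>j\<close> for one constant \<open>K\<close>. But \<open>L\<close> has points within bounded distance of every
  point of space, so \<open>L\<^sup>+\<close> has points arbitrarily far out in a fixed tube around the \<open>i\<close>-th axis,
  a contradiction (\<open>ex_indecomposable_on_axis\<close>). So \<open>L\<close> contains some \<open>a\<^sub>i e\<^sub>i\<close> with \<open>a\<^sub>i > 0\<close> for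
  every \<open>i\<close>, hence a box lattice, and the index is finite because every coset has a
  representative in a bounded box.
\<close>

section \<open>Full lattices\<close>

lemma lattice_int_combination:
  assumes "full_lattice L" "\<And>i. i \<in> I \<Longrightarrow> f i \<in> L"
  shows "(\<Sum>i\<in>I. of_int (k i) *\<^sub>R f i) \<in> L"
proof -
  obtain B where B: "L = {\<Sum>b\<in>B. of_int (c b) *\<^sub>R b | c :: real ^ 'a \<Rightarrow> int. True}"
    using assms(1) unfolding full_lattice_def lattice_basis_def by blast
  have "\<exists>c :: real ^ 'a \<Rightarrow> int. f i = (\<Sum>b\<in>B. of_int (c b) *\<^sub>R b)" if "i \<in> I" for i
    using assms(2)[OF that] unfolding B by blast
  then obtain c :: "_ \<Rightarrow> real ^ 'a \<Rightarrow> int"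
    where c: "\<And>i. i \<in> I \<Longrightarrow> f i = (\<Sum>b\<in>B. of_int (c i b) *\<^sub>R b)"
    by metis
  have "(\<Sum>i\<in>I. of_int (k i) *\<^sub>R f i) = (\<Sum>i\<in>I. \<Sum>b\<in>B. of_int (k i * c i b) *\<^sub>R b)"
    by (intro sum.cong refl) (simp add: c scaleR_sum_right)
  also have "\<dots> = (\<Sum>b\<in>B. of_int (\<Sum>i\<in>I. k i * c i b) *\<^sub>R b)"
    by (subst sum.swap) (simp add: scaleR_sum_left)
  finally show ?thesis
    unfolding B by (intro CollectI exI[where x = "\<lambda>b. \<Sum>i\<in>I. k i * c i b"] conjI TrueI)
qed

lemma lattice_zero: "full_lattice L \<Longrightarrow> 0 \<in> L"
  using lattice_int_combination[of L "{}"] by simp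

lemma lattice_diff: "full_lattice L \<Longrightarrow> x \<in> L \<Longrightarrow> y \<in> L \<Longrightarrow> x - y \<in> L"
  using lattice_int_combination[of L UNIV "\<lambda>t. if t then x else y" "\<lambda>t. if t then 1 else - 1"]
  by (simp add: UNIV_bool)

text \<open>The coordinates with respect to the basis are bounded linear functionals, so a bounded set
  allows only finitely many values of the integer coefficients.\<close>

lemma finite_lattice_Int_bounded:
  assumes L: "full_lattice L" and S: "bounded S"
  shows "finite (L \<inter> S)"
proof -
  obtain B where ind: "independent B"
    and B: "L = {\<Sum>b\<in>B. of_int (c b) *\<^sub>R b | c :: real ^ 'a \<Rightarrow> int. True}"
    using L unfolding full_lattice_def lattice_basis_def by blast
  have fin: "finite B"
    using ind by (rule independent_imp_finite)
  have "\<forall>b. \<exists>f. linear f \<and> (\<forall>b'\<in>B. f b' = (if b' = b then 1 else 0 :: real))"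
    by (intro allI linear_independent_extend ind)
  from choice[OF this] obtain f where f: "\<And>b. linear (f b)"
    "\<And>b b'. b' \<in> B \<Longrightarrow> f b b' = (if b' = b then 1 else 0 :: real)"
    by blast
  have "\<forall>b. \<exists>K. \<forall>x. \<bar>f b x\<bar> \<le> K * norm x"
    by (rule allI) (use linear_bounded[OF f(1)] in \<open>simp add: real_norm_def\<close>)
  from choice[OF this] obtain K where K: "\<And>b x. \<bar>f b x\<bar> \<le> K b * norm x"
    by blast
  obtain r where r: "\<And>x. x \<in> S \<Longrightarrow> norm x \<le> r"
    using S unfolding bounded_iff by blast
  define N where "N b = \<lceil>\<bar>K b\<bar> * r\<rceil>" for b
  have "L \<inter> S \<subseteq> (\<lambda>c. \<Sum>b\<in>B. of_int (c b) *\<^sub>R b) ` (\<Pi>\<^sub>E b\<in>B. {- N b..N b})"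
  proof
    fix x assume x: "x \<in> L \<inter> S"
    then obtain c :: "real ^ 'a \<Rightarrow> int" where c: "x = (\<Sum>b\<in>B. of_int (c b) *\<^sub>R b)"
      unfolding B by blast
    have "c b \<in> {- N b..N b}" if b: "b \<in> B" for b
    proof -
      have "f b x = (\<Sum>b'\<in>B. of_int (c b') * f b b')"
        unfolding c by (simp add: linear_sum[OF f(1)] linear_scale[OF f(1)])
      also have "\<dots> = (\<Sum>b'\<in>B. if b' = b then of_int (c b') else 0)"
        by (intro sum.cong refl) (simp add: f(2))
      also have "\<dots> = of_int (c b)"
        using b fin by simp
      finally have "\<bar>real_of_int (c b)\<bar> \<le> K b * norm x"
        using K[of b x] by simp
      also have "\<dots> \<le> \<bar>K b\<bar> * r"
        using r[of x] x by (intro mult_mono) auto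
      also have "\<dots> \<le> of_int (N b)"
        by (simp add: N_def)
      finally show ?thesis
        by simp linarith
    qed
    then have "restrict c B \<in> (\<Pi>\<^sub>E b\<in>B. {- N b..N b})"
      by auto
    moreover have "x = (\<Sum>b\<in>B. of_int (restrict c B b) *\<^sub>R b)"
      unfolding c by (intro sum.cong) auto
    ultimately show "x \<in> (\<lambda>c. \<Sum>b\<in>B. of_int (c b) *\<^sub>R b) ` (\<Pi>\<^sub>E b\<in>B. {- N b..N b})"
      by blast
  qed
  moreover have "finite (\<Pi>\<^sub>E b\<in>B. {- N b..N b})"
    using fin by (intro finite_PiE) auto
  ultimately show ?thesis
    using finite_surj by blast
qed

text \<open>Rounding the coordinates of a point down to integers moves it by at most the total length
  of the basis vectors.\<close>

lemma lattice_covering_radius: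
  assumes "full_lattice L"
  obtains C where "\<And>p. \<exists>x\<in>L. norm (x - p) \<le> C"
proof -
  obtain B where ind: "independent B" and card: "card B = CARD('a)"
    and B: "L = {\<Sum>b\<in>B. of_int (c b) *\<^sub>R b | c :: real ^ 'a \<Rightarrow> int. True}"
    using assms unfolding full_lattice_def lattice_basis_def by blast
  have fin: "finite B"
    using ind by (rule independent_imp_finite)
  have span: "span B = UNIV"
    using card_ge_dim_independent[of B UNIV] ind card by auto
  have "\<exists>x\<in>L. norm (x - p) \<le> (\<Sum>b\<in>B. norm b)" for p
  proof -
    have "p \<in> range (\<lambda>u. \<Sum>b\<in>B. u b *\<^sub>R b)"
      using span span_finite[OF fin] by simp
    then obtain u where u: "p = (\<Sum>b\<in>B. u b *\<^sub>R b)"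
      by (rule imageE)
    have "norm ((\<Sum>b\<in>B. of_int \<lfloor>u b\<rfloor> *\<^sub>R b) - p) = norm (\<Sum>b\<in>B. (of_int \<lfloor>u b\<rfloor> - u b) *\<^sub>R b)"
      by (simp add: u scaleR_diff_left sum_subtractf)
    also have "\<dots> \<le> (\<Sum>b\<in>B. norm b)"
    proof (rule sum_norm_le)
      fix b assume "b \<in> B"
      have "\<bar>of_int \<lfloor>u b\<rfloor> - u b\<bar> \<le> 1"
        by linarith
      then show "norm ((of_int \<lfloor>u b\<rfloor> - u b) *\<^sub>R b) \<le> norm b"
        by (simp add: mult_left_le_one_le)
    qed
    finally show ?thesis
      unfolding B
      by (rule bexI) (intro CollectI exI[where x = "\<lambda>b. \<lfloor>u b\<rfloor>"] conjI refl TrueI)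
  qed
  then show ?thesis
    using that by blast
qed

section \<open>Positive rectangular lattices\<close>

definition box_lattice :: "('n \<Rightarrow> real) \<Rightarrow> (real ^ 'n) set" where
  "box_lattice a = {x. \<forall>i. \<exists>k::int. x $ i = of_int k * a i}"

lemma box_lattice_eq_combinations:
  "box_lattice a = {\<Sum>i\<in>UNIV. of_int (k i) *\<^sub>R axis i (a i) | k :: 'n::finite \<Rightarrow> int. True}"
proof -
  have coord: "(\<Sum>i\<in>UNIV. of_int (k i) *\<^sub>R axis i (a i)) = (\<chi> i. of_int (k i) * a i)"
    for k :: "'n \<Rightarrow> int"
    by (simp add: vec_eq_iff axis_def if_distrib[of "(*) _"] cong: if_cong)
  show ?thesis
    unfolding box_lattice_def coord
    by (auto simp: vec_eq_iff choice_iff)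
qed

lemma axis_mem_box_lattice: "axis i (a i) \<in> box_lattice a"
proof -
  have "\<exists>k::int. axis i (a i) $ j = of_int k * a j" for j
    by (rule exI[where x = "if j = i then 1 else 0"]) (simp add: axis_def)
  then show ?thesis
    by (simp add: box_lattice_def)
qed

lemma box_lattice_diff:
  assumes "x \<in> box_lattice a" "y \<in> box_lattice a"
  shows "x - y \<in> box_lattice a"
  unfolding box_lattice_def
proof (intro CollectI allI)
  fix i
  obtain k l :: int where "x $ i = of_int k * a i" "y $ i = of_int l * a i"
    using assms unfolding box_lattice_def by blast
  then show "\<exists>m::int. (x - y) $ i = of_int m * a i"
    by (intro exI[where x = "k - l"]) (simp add: left_diff_distrib)
qed

lemma lattice_basis_axes:
  fixes a :: "'n::finite \<Rightarrow> real"
  assumes "\<And>i. 0 < a i"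
  shows "lattice_basis (range (\<lambda>i. axis i (a i))) M \<longleftrightarrow> M = box_lattice a"
    and "card (range (\<lambda>i. axis i (a i))) = CARD('n)"
    and "pairwise orthogonal (range (\<lambda>i. axis i (a i)))"
proof -
  have nz: "a i \<noteq> 0" for i
    using assms[of i] by simp
  have inj: "inj (\<lambda>i. axis i (a i))"
    by (rule injI) (use nz in \<open>auto simp: axis_eq_axis\<close>)
  show orth: "pairwise orthogonal (range (\<lambda>i. axis i (a i)))"
    by (auto simp: pairwise_def orthogonal_def inner_axis_axis)
  have "0 \<notin> range (\<lambda>i. axis i (a i))"
    using nz by (auto simp: axis_eq_0_iff dest!: sym[of 0])
  with orth have ind: "independent (range (\<lambda>i. axis i (a i)))"
    by (rule pairwise_orthogonal_independent)
  show "card (range (\<lambda>i. axis i (a i))) = CARD('n)"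
    using inj by (rule card_image)
  have sum: "(\<Sum>b\<in>range (\<lambda>i. axis i (a i)). of_int (c b) *\<^sub>R b)
      = (\<Sum>i\<in>UNIV. of_int (c (axis i (a i))) *\<^sub>R axis i (a i))" for c :: "real ^ 'n \<Rightarrow> int"
    using inj by (simp add: sum.reindex)
  have "{\<Sum>b\<in>range (\<lambda>i. axis i (a i)). of_int (c b) *\<^sub>R b | c :: real ^ 'n \<Rightarrow> int. True}
      = box_lattice a"
  proof (intro equalityI subsetI)
    fix x assume "x \<in> box_lattice a"
    then obtain k :: "'n \<Rightarrow> int" where k: "x = (\<Sum>i\<in>UNIV. of_int (k i) *\<^sub>R axis i (a i))"
      unfolding box_lattice_eq_combinations by blast
    \<comment> \<open>The index of a basis vector can be read off, so coefficients given by index are given by vector.\<close>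
    define c where "c = (\<lambda>b. k (inv (\<lambda>i. axis i (a i)) b))"
    have "c (axis i (a i)) = k i" for i
      using inv_f_f[OF inj] by (simp add: c_def)
    then have "x = (\<Sum>b\<in>range (\<lambda>i. axis i (a i)). of_int (c b) *\<^sub>R b)"
      by (simp only: k sum)
    then show "x \<in> {\<Sum>b\<in>range (\<lambda>i. axis i (a i)). of_int (c b) *\<^sub>R b | c :: real ^ 'n \<Rightarrow> int. True}"
      by (intro CollectI exI[where x = c] conjI TrueI)
  next
    fix x
    assume "x \<in> {\<Sum>b\<in>range (\<lambda>i. axis i (a i)). of_int (c b) *\<^sub>R b | c :: real ^ 'n \<Rightarrow> int. True}"
    then obtain c :: "real ^ 'n \<Rightarrow> int"
      where "x = (\<Sum>i\<in>UNIV. of_int (c (axis i (a i))) *\<^sub>R axis i (a i))"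
      unfolding sum by (elim CollectE exE conjE)
    then show "x \<in> box_lattice a"
      unfolding box_lattice_eq_combinations
      by (intro CollectI exI[where x = "\<lambda>i. c (axis i (a i))"] conjI TrueI)
  qed
  then show "lattice_basis (range (\<lambda>i. axis i (a i))) M \<longleftrightarrow> M = box_lattice a"
    using ind by (simp add: lattice_basis_def)
qed

text \<open>Choosing a coordinate in the support of each basis vector is injective because the supports
  are disjoint, hence bijective by counting; so no support can have a second element.\<close>

lemma positive_orthogonal_basis_is_axes:
  fixes B :: "(real ^ 'n) set"
  assumes "independent B" "card B = CARD('n)" and orth: "pairwise orthogonal B"
    and nonneg: "\<And>b i. b \<in> B \<Longrightarrow> 0 \<le> b $ i"
  obtains a where "\<And>i. 0 < a i" "B = range (\<lambda>i. axis i (a i))"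
proof -
  have fin: "finite B"
    using assms(1) by (rule independent_imp_finite)
  have "\<exists>i. b $ i \<noteq> 0" if "b \<in> B" for b
    using that assms(1) dependent_zero by (metis vec_eq_iff zero_index)
  then obtain s where s: "\<And>b. b \<in> B \<Longrightarrow> b $ s b \<noteq> 0"
    by metis
  have disj: "b = b'" if "b \<in> B" "b' \<in> B" "b $ i \<noteq> 0" "b' $ i \<noteq> 0" for b b' i
  proof (rule ccontr)
    assume "b \<noteq> b'"
    then have "(\<Sum>j\<in>UNIV. b $ j * b' $ j) = 0"
      using orth that by (auto simp: pairwise_def orthogonal_def inner_vec_def)
    then have "b $ i * b' $ i = 0"
      using that(1,2) nonneg by (subst (asm) sum_nonneg_eq_0_iff) auto
    with that show False
      by simp
  qed
  have inj: "inj_on s B"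
    using disj s by (metis inj_onI)
  then have surj: "s ` B = UNIV"
    using assms(2) by (intro card_seteq) (simp_all add: card_image)
  define t where "t = inv_into B s"
  have t: "t i \<in> B" "s (t i) = i" for i
    using surj by (auto simp: t_def inv_into_into f_inv_into_f)
  have off: "t i $ j = 0" if "j \<noteq> i" for i j
    using disj[of "t i" "t j" j] t s that by metis
  have "axis i (t i $ i) = t i" for i
    using off by (auto simp: vec_eq_iff axis_def)
  moreover have "range t = B"
    using inj surj by (simp add: t_def bij_betw_def bij_betw_imp_surj_on[OF bij_betw_inv_into])
  moreover have "0 < t i $ i" for i
    using s[of "t i"] nonneg[of "t i" i] t[of i] by simp
  ultimately show ?thesis
    using that[of "\<lambda>i. t i $ i"] by simp
qed

lemma positive_rectangular_iff_box_lattice: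
  fixes M :: "(real ^ 'n) set"
  shows "positive_rectangular M \<longleftrightarrow> (\<exists>a. (\<forall>i. 0 < a i) \<and> M = box_lattice a)"
proof
  assume "positive_rectangular M"
  then obtain B where B: "lattice_basis B M" "card B = CARD('n)" "pairwise orthogonal B"
    "\<And>b i. b \<in> B \<Longrightarrow> 0 \<le> b $ i"
    unfolding positive_rectangular_def by blast
  then have "independent B"
    by (simp add: lattice_basis_def)
  then obtain a where "\<And>i. 0 < a i" "B = range (\<lambda>i. axis i (a i))"
    using positive_orthogonal_basis_is_axes B by metis
  then show "\<exists>a. (\<forall>i. 0 < a i) \<and> M = box_lattice a"
    using B(1) lattice_basis_axes(1) by metis
next
  assume "\<exists>a. (\<forall>i. 0 < a i) \<and> M = box_lattice a"
  then obtain a where a: "\<And>i. 0 < a i" and M: "M = box_lattice a"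
    by blast
  have "\<forall>b\<in>range (\<lambda>i. axis i (a i)). \<forall>i. 0 \<le> b $ i"
    using a by (auto simp: axis_def less_imp_le)
  then show "positive_rectangular M"
    unfolding positive_rectangular_def using lattice_basis_axes[where a = a, OF a] M by blast
qed

lemma box_lattice_subset:
  fixes L :: "(real ^ 'n) set"
  assumes "full_lattice L" "\<And>i. axis i (a i) \<in> L"
  shows "box_lattice a \<subseteq> L"
  using lattice_int_combination[OF assms(1), of UNIV "\<lambda>i. axis i (a i)"] assms(2)
  by (auto simp: box_lattice_eq_combinations)

text \<open>Every coset has a representative in the box \<open>\<Prod>\<^sub>i [0, a\<^sub>i]\<close>.\<close>

lemma finite_cosets_box_lattice:
  fixes L :: "(real ^ 'n) set"
  assumes L: "full_lattice L" and a: "\<And>i. 0 < a i" and sub: "box_lattice a \<subseteq> L"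
  shows "finite (cosets L (box_lattice a))"
proof -
  let ?M = "box_lattice a"
  have "cosets L ?M \<subseteq> (\<lambda>x. (+) x ` ?M) ` (L \<inter> cbox 0 (\<chi> i. a i))"
    unfolding cosets_def
  proof safe
    fix x assume x: "x \<in> L"
    define m where "m = (\<chi> i. of_int \<lfloor>x $ i / a i\<rfloor> * a i)"
    have m: "m \<in> ?M"
      by (auto simp: box_lattice_def m_def)
    have "0 \<le> x $ i - m $ i \<and> x $ i - m $ i \<le> a i" for i
    proof -
      have "of_int \<lfloor>x $ i / a i\<rfloor> * a i \<le> x $ i" "x $ i < (of_int \<lfloor>x $ i / a i\<rfloor> + 1) * a i"
        by (rule floor_divide_lower[OF a], rule floor_divide_upper[OF a])
      then show ?thesis
        by (simp add: m_def distrib_right)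
    qed
    then have "x - m \<in> L \<inter> cbox 0 (\<chi> i. a i)"
      using lattice_diff[OF L x] m sub by (auto simp: mem_box_cart)
    moreover have "(+) x ` ?M = (+) (x - m) ` ?M"
    proof safe
      fix y assume y: "y \<in> ?M"
      have "0 \<in> ?M"
        using box_lattice_diff[OF m m] by simp
      then have "m + y \<in> ?M"
        using box_lattice_diff[OF y box_lattice_diff[of 0 a m]] m by (simp add: add.commute)
      then show "x + y \<in> (+) (x - m) ` ?M"
        by (intro image_eqI[where x = "m + y"]) auto
    next
      fix y assume y: "y \<in> ?M"
      then show "x - m + y \<in> (+) x ` ?M"
        using box_lattice_diff[OF y m] by (intro image_eqI[where x = "y - m"]) auto
    qed
    ultimately show "(+) x ` ?M \<in> (\<lambda>x. (+) x ` ?M) ` (L \<inter> cbox 0 (\<chi> i. a i))"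
      by blast
  qed
  moreover have "finite (L \<inter> cbox 0 (\<chi> i. a i))"
    by (intro finite_lattice_Int_bounded L bounded_cbox)
  ultimately show ?thesis
    using finite_surj by blast
qed

section \<open>The bound for positive virtually rectangular lattices\<close>

text \<open>From a vector whose \<open>i\<close>-th coordinate is at least \<open>a\<^sub>i\<close>, the vector \<open>a\<^sub>i e\<^sub>i\<close> can be split
  off.\<close>

lemma indecomposable_cases:
  assumes L: "full_lattice L" and a: "\<And>i. 0 < a i" and sub: "box_lattice a \<subseteq> L"
    and x: "x \<in> indecomposables L"
  shows "(\<exists>i. x = axis i (a i)) \<or> (\<forall>i. x $ i < a i)"
proof (rule ccontr)
  assume neg: "\<not> ?thesis"
  then obtain i where i: "a i \<le> x $ i" and ne: "x \<noteq> axis i (a i)"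
    by (auto simp: not_less)
  have xL: "x \<in> L" "\<And>j. 0 \<le> x $ j" and nd: "\<not> decomposable L x"
    using x by (auto simp: indecomposables_def nonneg_part_def)
  have ax: "axis i (a i) \<in> L"
    using axis_mem_box_lattice sub by blast
  have "axis i (a i) \<in> nonneg_part L" "x - axis i (a i) \<in> nonneg_part L"
    using ax xL i a[of i] lattice_diff[OF L xL(1) ax] by (auto simp: nonneg_part_def axis_def)
  moreover have "axis i (a i) \<noteq> 0"
    using a[of i] by (simp add: axis_eq_0_iff)
  ultimately have "decomposable L x"
    unfolding decomposable_def using ne
    by (intro bexI[where x = "axis i (a i)"] bexI[where x = "x - axis i (a i)"]) auto
  with nd show False
    by contradiction
qed

text \<open>Two points of the half-open box that are congruent modulo the box lattice differ by less than
  one side length in each coordinate, so they coincide.\<close>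

lemma inj_on_coset_half_open_box:
  assumes a: "\<And>i. 0 < a i"
  shows "inj_on (\<lambda>x. (+) x ` box_lattice a) {x. \<forall>i. 0 \<le> x $ i \<and> x $ i < a i}"
proof (rule inj_onI)
  fix x y
  assume x: "x \<in> {x. \<forall>i. 0 \<le> x $ i \<and> x $ i < a i}" and y: "y \<in> {x. \<forall>i. 0 \<le> x $ i \<and> x $ i < a i}"
    and eq: "(+) x ` box_lattice a = (+) y ` box_lattice a"
  have "0 \<in> box_lattice a"
    using box_lattice_diff[OF axis_mem_box_lattice axis_mem_box_lattice] by (metis diff_self)
  then have "x + 0 \<in> (+) y ` box_lattice a"
    unfolding eq[symmetric] by blast
  then obtain m where m: "m \<in> box_lattice a" "x = y + m"
    by auto
  show "x = y"
    unfolding vec_eq_iff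
  proof
    fix i
    obtain k :: int where k: "m $ i = of_int k * a i"
      using m(1) by (auto simp: box_lattice_def)
    have "\<bar>x $ i - y $ i\<bar> < a i"
      using x y by (auto simp: abs_if dest!: spec[of _ i])
    then have "\<bar>of_int k\<bar> * a i < 1 * a i"
      using a[of i] m(2) k by (simp add: abs_mult)
    then have "\<bar>of_int k :: real\<bar> < 1"
      using a[of i] by (simp only: mult_less_cancel_right_pos)
    then have "k = 0"
      by linarith
    then show "x $ i = y $ i"
      using m(2) k by simp
  qed
qed

lemma indecomposables_bound:
  fixes L :: "(real ^ 'n) set"
  assumes L: "full_lattice L" and M: "finite_index_PR_sublattice L M"
  shows "finite (indecomposables L)"
    and "card (indecomposables L) \<le> lattice_index L M + CARD('n) - 1"
proof -
  obtain a where a: "\<And>i. 0 < a i" and Ma: "M = box_lattice a"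
    using M unfolding finite_index_PR_sublattice_def positive_rectangular_iff_box_lattice by blast
  have sub: "box_lattice a \<subseteq> L" and fin: "finite (cosets L M)"
    using M Ma by (auto simp: finite_index_PR_sublattice_def)
  define X where "X = {x \<in> indecomposables L. \<forall>i. x $ i < a i}"
  have "insert 0 X \<subseteq> {x. \<forall>i. 0 \<le> x $ i \<and> x $ i < a i}"
    using a by (auto simp: X_def indecomposables_def nonneg_part_def)
  then have inj: "inj_on (\<lambda>x. (+) x ` M) (insert 0 X)"
    using inj_on_coset_half_open_box[of a, OF a] unfolding Ma by (rule inj_on_subset[rotated])
  have img: "(\<lambda>x. (+) x ` M) ` insert 0 X \<subseteq> cosets L M"
    unfolding cosets_def using lattice_zero[OF L]
    by (intro image_mono) (auto simp: X_def indecomposables_def nonneg_part_def)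
  have "finite (insert 0 X)"
    using inj img fin by (rule inj_on_finite)
  then have finX: "finite X"
    by simp
  have "0 \<notin> X"
    by (simp add: X_def indecomposables_def)
  then have cX: "card X + 1 \<le> lattice_index L M"
    using card_inj_on_le[OF inj img fin] finX by (simp add: lattice_index_def)
  have incl: "indecomposables L \<subseteq> range (\<lambda>i. axis i (a i)) \<union> X"
    using indecomposable_cases[OF L a sub] by (auto simp: X_def)
  then show "finite (indecomposables L)"
    by (rule finite_subset) (simp add: finX)
  have "card (indecomposables L) \<le> card (range (\<lambda>i. axis i (a i)) \<union> X)"
    using incl by (intro card_mono) (simp_all add: finX)
  also have "\<dots> \<le> CARD('n) + card X"
    using card_Un_le[of "range (\<lambda>i. axis i (a i))" X] lattice_basis_axes(2)[where a = a, OF a] by simp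
  finally show "card (indecomposables L) \<le> lattice_index L M + CARD('n) - 1"
    using cX by linarith
qed

section \<open>Finitely many indecomposables force a positive rectangular sublattice\<close>

text \<open>Indecomposable vectors generate the monoid: both summands of a decomposition have strictly
  fewer points of the monoid below them, and these numbers are finite.\<close>

lemma nonneg_part_induct [consumes 2, case_names zero indecomposable add]:
  fixes L :: "(real ^ 'n) set"
  assumes L: "full_lattice L" and "x \<in> nonneg_part L"
    and "P 0" and "\<And>g. g \<in> indecomposables L \<Longrightarrow> P g" and "\<And>y z. P y \<Longrightarrow> P z \<Longrightarrow> P (y + z)"
  shows "P x"
  using assms(2)
proof (induction "card (L \<inter> cbox 0 x)" arbitrary: x rule: less_induct)
  case less
  consider "x = 0" | "x \<in> indecomposables L" | "decomposable L x"
    using less.prems by (auto simp: indecomposables_def)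
  then show ?case
  proof cases
    case 3
    then obtain y z where yz: "y \<in> nonneg_part L" "z \<in> nonneg_part L" "y \<noteq> 0" "z \<noteq> 0" "x = y + z"
      unfolding decomposable_def by blast
    have smaller: "card (L \<inter> cbox 0 u) < card (L \<inter> cbox 0 (u + v))"
      if uv: "u \<in> nonneg_part L" "v \<in> nonneg_part L" "v \<noteq> 0" "u + v \<in> nonneg_part L" for u v
    proof (rule psubset_card_mono)
      show "finite (L \<inter> cbox 0 (u + v))"
        by (intro finite_lattice_Int_bounded L bounded_cbox)
      have "w $ i \<le> u $ i + v $ i" if "w $ i \<le> u $ i" for w i
        using that uv(2) by (auto simp: nonneg_part_def intro: order_trans add_increasing2)
      then have "L \<inter> cbox 0 u \<subseteq> L \<inter> cbox 0 (u + v)"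
        by (auto simp: mem_box_cart)
      moreover have "u + v \<in> L \<inter> cbox 0 (u + v)"
        using uv(4) by (auto simp: nonneg_part_def mem_box_cart)
      moreover have "u + v \<notin> cbox 0 u"
      proof
        assume "u + v \<in> cbox 0 u"
        then have "v $ i \<le> 0" for i
          by (auto simp: mem_box_cart)
        with uv(2) have "v = 0"
          by (auto simp: nonneg_part_def vec_eq_iff intro: antisym)
        with uv(3) show False ..
      qed
      ultimately show "L \<inter> cbox 0 u \<subset> L \<inter> cbox 0 (u + v)"
        by blast
    qed
    have "P y"
      using smaller[of y z] yz less.prems by (intro less.hyps) auto
    moreover have "P z"
      using smaller[of z y] yz less.prems by (intro less.hyps) (auto simp: add.commute)
    ultimately show ?thesis
      unfolding yz(5) by (rule assms(5))
  qed (use assms(3,4) in auto)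
qed

text \<open>Lattice points in the orthant go arbitrarily far along an axis while staying in a fixed tube
  around it: take lattice points close to points of the axis that have been shifted by the covering radius
  in every coordinate, so that they stay in the orthant.\<close>

lemma nonneg_part_unbounded_along_axis:
  fixes L :: "(real ^ 'n) set"
  assumes "full_lattice L"
  obtains C where "\<And>N i. \<exists>x\<in>nonneg_part L. N \<le> x $ i \<and> (\<forall>j. j \<noteq> i \<longrightarrow> x $ j \<le> C)"
proof -
  obtain C where C: "\<And>p. \<exists>x\<in>L. norm (x - p) \<le> C"
    using lattice_covering_radius[OF assms] by blast
  have "\<exists>x\<in>nonneg_part L. N \<le> x $ i \<and> (\<forall>j. j \<noteq> i \<longrightarrow> x $ j \<le> 2 * C)" for N i
  proof -
    define p :: "real ^ 'n" where "p = (\<chi> j. if j = i then \<bar>N\<bar> + C else C)"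
    obtain x where x: "x \<in> L" "norm (x - p) \<le> C"
      using C by blast
    have near: "\<bar>x $ j - p $ j\<bar> \<le> C" for j
      using component_le_norm_cart[of "x - p" j] x(2) by simp
    have "0 \<le> x $ j" for j
      using near[of j] by (auto simp: p_def split: if_splits)
    moreover have "N \<le> x $ i"
      using near[of i] by (simp add: p_def)
    moreover have "x $ j \<le> 2 * C" if "j \<noteq> i" for j
      using near[of j] that by (simp add: p_def)
    ultimately show ?thesis
      using x(1) by (auto simp: nonneg_part_def)
  qed
  then show ?thesis
    using that by blast
qed

text \<open>Otherwise each of the finitely many generators has a nonzero coordinate off the axis, so that
  the ratio of its \<open>i\<close>-th coordinate to the sum of the others is bounded. The bound passes to
  sums and contradicts the unboundedness of the monoid along the axis.\<close>

lemma ex_indecomposable_on_axis: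
  fixes L :: "(real ^ 'n) set"
  assumes L: "full_lattice L" and fin: "finite (indecomposables L)"
  shows "\<exists>a>0. axis i a \<in> L"
proof (rule ccontr)
  assume none: "\<not> (\<exists>a>0. axis i a \<in> L)"
  define off where "off x = (\<Sum>j\<in>UNIV - {i}. x $ j)" for x :: "real ^ 'n"
  have off_pos: "0 < off g" if g: "g \<in> indecomposables L" for g
  proof (rule ccontr)
    have nonneg: "0 \<le> g $ j" for j
      using g by (auto simp: indecomposables_def nonneg_part_def)
    assume "\<not> 0 < off g"
    moreover have "0 \<le> off g"
      unfolding off_def using nonneg by (intro sum_nonneg)
    ultimately have "off g = 0"
      by simp
    then have "g $ j = 0" if "j \<noteq> i" for j
      using that nonneg unfolding off_def by (subst (asm) sum_nonneg_eq_0_iff) auto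
    then have eq: "g = axis i (g $ i)"
      by (auto simp: vec_eq_iff axis_def)
    have "g \<noteq> 0" "g \<in> L"
      using g by (auto simp: indecomposables_def nonneg_part_def)
    then have "g $ i \<noteq> 0" "axis i (g $ i) \<in> L"
      using eq by (metis axis_eq_0_iff, metis)
    then show False
      using none nonneg[of i] by (metis less_eq_real_def)
  qed
  define K where "K = Max (insert 0 ((\<lambda>g. g $ i / off g) ` indecomposables L))"
  have "0 \<le> K"
    unfolding K_def using fin by (intro Max_ge) auto
  have bound: "x $ i \<le> K * off x" if "x \<in> nonneg_part L" for x
    using L that
  proof (induction rule: nonneg_part_induct)
    case zero
    then show ?case
      by (simp add: off_def)
  next
    case (indecomposable g)
    then have "g $ i / off g \<le> K"
      unfolding K_def using fin by (intro Max_ge) auto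
    then show ?case
      using off_pos[OF indecomposable] by (simp add: pos_divide_le_eq)
  next
    case (add y z)
    then show ?case
      by (simp add: off_def sum.distrib distrib_left)
  qed
  obtain C where C: "\<And>N i. \<exists>x\<in>nonneg_part L. N \<le> x $ i \<and> (\<forall>j. j \<noteq> i \<longrightarrow> x $ j \<le> C)"
    using nonneg_part_unbounded_along_axis[OF L] by metis
  define T where "T = K * (\<Sum>j\<in>UNIV - {i}. C)"
  obtain x where x: "x \<in> nonneg_part L" "T + 1 \<le> x $ i" "\<And>j. j \<noteq> i \<Longrightarrow> x $ j \<le> C"
    using C[of "T + 1" i] by blast
  have "off x \<le> (\<Sum>j\<in>UNIV - {i}. C)"
    unfolding off_def using x(3) by (intro sum_mono) auto
  then have "K * off x \<le> T"
    unfolding T_def using \<open>0 \<le> K\<close> by (rule mult_left_mono)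
  then show False
    using bound[OF x(1)] x(2) by linarith
qed

lemma positive_virtually_rectangular_if_finite_indecomposables:
  fixes L :: "(real ^ 'n) set"
  assumes L: "full_lattice L" and fin: "finite (indecomposables L)"
  shows "positive_virtually_rectangular L"
proof -
  obtain a where a: "\<And>i. 0 < a i" and aL: "\<And>i. axis i (a i) \<in> L"
    using ex_indecomposable_on_axis[OF L fin] by metis
  have sub: "box_lattice a \<subseteq> L"
    using L aL by (rule box_lattice_subset)
  have "finite_index_PR_sublattice L (box_lattice a)"
    unfolding finite_index_PR_sublattice_def positive_rectangular_iff_box_lattice
    using a sub finite_cosets_box_lattice[OF L a sub] by blast
  then show ?thesis
    unfolding positive_virtually_rectangular_def by blast
qed

section \<open>The dichotomy\<close>

theorem theorem1p1:
  fixes L :: "(real ^ 'n) set"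
  assumes "CARD('n) \<ge> 2"
    and "full_lattice L"
  shows "(positive_virtually_rectangular L \<longrightarrow>
            finite (indecomposables L) \<and>
            card (indecomposables L) \<le> min_PR_index L + CARD('n) - 1) \<and>
         (\<not> positive_virtually_rectangular L \<longrightarrow> infinite (indecomposables L))"
proof (intro conjI impI)
  assume "positive_virtually_rectangular L"
  then have "\<exists>k M. finite_index_PR_sublattice L M \<and> k = lattice_index L M"
    unfolding positive_virtually_rectangular_def by blast
  then have "\<exists>M. finite_index_PR_sublattice L M \<and> min_PR_index L = lattice_index L M"
    unfolding min_PR_index_def by (rule LeastI_ex)
  then obtain M where "finite_index_PR_sublattice L M" "min_PR_index L = lattice_index L M"
    by blast
  then show "finite (indecomposables L)"
    and "card (indecomposables L) \<le> min_PR_index L + CARD('n) - 1"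
    using indecomposables_bound[OF assms(2)] by auto
next
  assume "\<not> positive_virtually_rectangular L"
  then show "infinite (indecomposables L)"
    using positive_virtually_rectangular_if_finite_indecomposables[OF assms(2)] by blast
qed

end
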